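(* Let $a,\eta>0$ and set $$\bar\lambda=\frac1T\|\beta e_T\|_2^2+\eta\|b\|_2^2+\frac1a\Big\|\frac{\beta}{T}R^\top e_T+\eta A^\top b\Big\|_\infty+\frac1a\sqrt{\Big\|\frac{\beta}{T}R^\top e_T+\eta A^\top b\Big\|_\infty^2+2a\Big(\frac1T\|\beta e_T\|_2^2+\eta\|b\|_2^2\Big)\Big\|\frac{\beta}{T}R^\top e_T+\eta A^\top b\Big\|_\infty}\,.$$ Then for all $\lambda\ge\bar\lambda$, the problem $(FP_{a,\lambda,\eta})$ admits the zero solution, i.e. $x=0$ is an optimal solution (global minimizer) of $(FP_{a,\lambda,\eta})$.
   Context: Let $T,n$ be positive integers, $r_1,\dots,r_T\in\mathbb{R}^n$ the vectors of asset returns, $R=(r_1,\dots,r_T)^\top\in\mathbb{R}^{T\times n}$, $\mu\in\mathbb{R}^n$ the (given) mean return vector, $\beta\in\mathbb{R}$, $e_m\in\mathbb{R}^m$ the vector of all ones, $A=(\mu,e_n)^\top\in\mathbb{R}^{2\times n}$, $b=(\beta,1)^\top\in\mathbb{R}^2$. For $a>0$ let $\rho_a(t)=\frac{a|t|}{a|t|+1}$ for $t\in\mathbb{R}$ and $P_a(x)=\sum_i\rho_a(x_i)$. For $\lambda,\eta>0$ the problem $(FP_{a,\lambda,\eta})$ is the minimization over $x\in\mathbb{R}^n$ of $$\frac1T\|Rx-\beta e_T\|_2^2+\lambda P_a(x)+\eta\|Ax-b\|_2^2 .$$ *)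

theory Defs
  imports "HOL-Analysis.Analysis"
begin

text \<open>
  The dimensions \<open>n\<close> and \<open>T\<close> are the cardinalities of the finite index types \<open>'n\<close> and \<open>'t\<close>.
  The all-ones vector is the library's \<open>1 :: real ^ 'm\<close>, \<^term>\<open>norm\<close> on \<open>real ^ 'm\<close> is the
  Euclidean norm, and \<^term>\<open>infnorm\<close> is the maximum norm.
\<close>

definition frac_rho :: "real \<Rightarrow> real \<Rightarrow> real" where
  "frac_rho a t = a * \<bar>t\<bar> / (a * \<bar>t\<bar> + 1)"

definition frac_penalty :: "real \<Rightarrow> real ^ 'n \<Rightarrow> real" where
  "frac_penalty a x = (\<Sum>i\<in>UNIV. frac_rho a (x $ i))"

definition return_matrix :: "('t \<Rightarrow> real ^ 'n) \<Rightarrow> real ^ 'n ^ 't" where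
  "return_matrix r = (\<chi> t. r t)"

definition constraint_matrix :: "real ^ 'n \<Rightarrow> real ^ 'n ^ 2" where
  "constraint_matrix \<mu> = vector [\<mu>, 1]"

definition constraint_rhs :: "real \<Rightarrow> real ^ 2" where
  "constraint_rhs \<beta> = vector [\<beta>, 1]"

definition FP_objective ::
  "('t::finite \<Rightarrow> real ^ 'n) \<Rightarrow> real ^ 'n \<Rightarrow> real \<Rightarrow> real \<Rightarrow> real \<Rightarrow> real \<Rightarrow> real ^ 'n \<Rightarrow> real" where
  "FP_objective r \<mu> \<beta> a lam \<eta> x =
     1 / real CARD('t) * (norm (return_matrix r *v x - \<beta> *\<^sub>R 1))\<^sup>2
     + lam * frac_penalty a x
     + \<eta> * (norm (constraint_matrix \<mu> *v x - constraint_rhs \<beta>))\<^sup>2"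

definition FP_optimal ::
  "('t::finite \<Rightarrow> real ^ 'n) \<Rightarrow> real ^ 'n \<Rightarrow> real \<Rightarrow> real \<Rightarrow> real \<Rightarrow> real \<Rightarrow> real ^ 'n \<Rightarrow> bool" where
  "FP_optimal r \<mu> \<beta> a lam \<eta> x \<longleftrightarrow> is_arg_min (FP_objective r \<mu> \<beta> a lam \<eta>) (\<lambda>y. y \<in> UNIV) x"

definition lambda_bar ::
  "('t::finite \<Rightarrow> real ^ 'n) \<Rightarrow> real ^ 'n \<Rightarrow> real \<Rightarrow> real \<Rightarrow> real \<Rightarrow> real" where
  "lambda_bar r \<mu> \<beta> a \<eta> =
     (let C = 1 / real CARD('t) * (norm (\<beta> *\<^sub>R (1 :: real ^ 't)))\<^sup>2
                + \<eta> * (norm (constraint_rhs \<beta>))\<^sup>2;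
          c = infnorm ((\<beta> / real CARD('t)) *\<^sub>R (transpose (return_matrix r) *v 1)
                + \<eta> *\<^sub>R (transpose (constraint_matrix \<mu>) *v constraint_rhs \<beta>))
      in C + 1 / a * c + 1 / a * sqrt (c\<^sup>2 + 2 * a * C * c))"

end

theory Submission
  imports Defs
begin

text \<open>
  Write \<open>C\<close> for the objective at zero, \<open>q\<close> for the vector whose maximum norm \<open>c\<close> enters the
  threshold, \<open>t\<close> for the 1-norm of \<open>x\<close> and \<open>p = a t / (a t + 1)\<close>. The penalty is
  subadditive, so it is at least \<open>p\<close>. The quadratic part of the objective is nonnegative and at
  least \<open>C - 2 q \<bullet> x \<ge> C - 2 c t\<close>. So \<open>x\<close> could beat zero only if both
  \<open>lam p < C\<close> and \<open>lam p < 2 c t\<close>. These contradict \<open>2 c \<le> a (lam - C)\<close>, which follows from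
  \<open>lam \<ge> lambda_bar\<close> by dropping the term \<open>2 a C c\<close> under the square root.
\<close>

text \<open>Over the common denominator \<open>a * (\<bar>s\<bar> + \<bar>t\<bar>) + 1\<close> the
  left side splits into two fractions, and shrinking each denominator to that of its own term only
  enlarges them.\<close>

lemma frac_rho_add_le:
  assumes "a > 0"
  shows "frac_rho a (\<bar>s\<bar> + \<bar>t\<bar>) \<le> frac_rho a s + frac_rho a t"
proof -
  have "frac_rho a (\<bar>s\<bar> + \<bar>t\<bar>)
      = a * \<bar>s\<bar> / (a * (\<bar>s\<bar> + \<bar>t\<bar>) + 1) + a * \<bar>t\<bar> / (a * (\<bar>s\<bar> + \<bar>t\<bar>) + 1)"
    by (simp add: frac_rho_def distrib_left add_divide_distrib)
  also have "\<dots> \<le> frac_rho a s + frac_rho a t"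
    unfolding frac_rho_def using assms
    by (intro add_mono divide_left_mono mult_pos_pos) (auto intro: add_nonneg_pos)
  finally show ?thesis .
qed

lemma frac_rho_sum_le:
  assumes "a > 0" "finite A"
  shows "frac_rho a (\<Sum>i\<in>A. \<bar>f i\<bar>) \<le> (\<Sum>i\<in>A. frac_rho a (f i))"
  using assms(2)
proof induction
  case empty
  then show ?case by (simp add: frac_rho_def)
next
  case (insert j A)
  have "frac_rho a (\<bar>f j\<bar> + (\<Sum>i\<in>A. \<bar>f i\<bar>)) \<le> frac_rho a (f j) + frac_rho a (\<Sum>i\<in>A. \<bar>f i\<bar>)"
    using frac_rho_add_le[OF assms(1), of "f j" "\<Sum>i\<in>A. \<bar>f i\<bar>"] by (simp add: sum_nonneg)
  with insert show ?case by simp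
qed

text \<open>Hoelder's inequality for the dual pair of the maximum norm and the 1-norm.\<close>

lemma inner_le_infnorm_mult_sum_abs:
  fixes q x :: "real ^ 'n"
  shows "q \<bullet> x \<le> infnorm q * (\<Sum>i\<in>UNIV. \<bar>x $ i\<bar>)"
proof -
  have "q $ i * x $ i \<le> infnorm q * \<bar>x $ i\<bar>" for i
  proof -
    have "q $ i * x $ i \<le> \<bar>q $ i\<bar> * \<bar>x $ i\<bar>"
      by (metis abs_ge_self abs_mult)
    also have "\<dots> \<le> infnorm q * \<bar>x $ i\<bar>"
      by (intro mult_right_mono component_le_infnorm_cart) simp
    finally show ?thesis .
  qed
  then show ?thesis
    by (simp add: inner_vec_def sum_distrib_left sum_mono)
qed

text \<open>Expand the square, discard the term \<open>(norm (M *v x))\<^sup>2\<close>, and move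
  \<open>M\<close> across the inner product as its transpose.\<close>

lemma norm_matrix_residual_ge:
  fixes M :: "real ^ 'n ^ 'm"
  shows "(norm y)\<^sup>2 - 2 * ((transpose M *v y) \<bullet> x) \<le> (norm (M *v x - y))\<^sup>2"
proof -
  have "(norm (M *v x - y))\<^sup>2 = (norm (M *v x))\<^sup>2 + (norm y)\<^sup>2 - 2 * ((M *v x) \<bullet> y)"
    by (simp add: power2_norm_eq_inner inner_diff inner_commute)
  moreover have "(M *v x) \<bullet> y = (transpose M *v y) \<bullet> x"
    by (metis dot_lmul_matrix inner_commute transpose_matrix_vector)
  ultimately show ?thesis by simp
qed

text \<open>If both bounds failed, the one by \<open>C\<close> would give
  \<open>(lam - C) * (a * t) < C\<close>, while the one by \<open>2 * c * t\<close>, divided by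
  \<open>t\<close> and combined with the threshold, would give the reverse strict
  inequality.\<close>

lemma min_le_mult_frac_rho:
  fixes C c lam t :: real
  assumes a: "a > 0" and t: "t \<ge> 0" and thr: "2 * c \<le> a * (lam - C)"
  shows "min C (2 * c * t) \<le> lam * frac_rho a t"
proof (rule ccontr)
  assume "\<not> ?thesis"
  then have C: "lam * frac_rho a t < C" and c: "lam * frac_rho a t < 2 * c * t"
    by auto
  \<comment> \<open>At \<open>t = 0\<close> both sides of \<open>c\<close> vanish, so the strict
    inequality rules this case out.\<close>
  from c t have "t > 0"
    by (cases "t = 0") (auto simp: frac_rho_def)
  then have pos: "0 < a * t + 1" using a by (simp add: add_pos_pos)
  have rho: "frac_rho a t = a * t / (a * t + 1)"
    using t by (simp add: frac_rho_def)
  from C pos have "lam * (a * t) < C * (a * t + 1)"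
    by (simp add: rho pos_divide_less_eq)
  then have C': "(lam - C) * (a * t) < C" by (simp add: algebra_simps)
  from c pos have "lam * a * t < 2 * c * (a * t + 1) * t"
    by (simp add: rho pos_divide_less_eq mult_ac)
  then have "lam * a < 2 * c * (a * t + 1)" using \<open>t > 0\<close> by simp
  also have "\<dots> \<le> a * (lam - C) * (a * t + 1)"
    using thr pos by (intro mult_right_mono) auto
  finally have "a * lam < a * ((lam - C) * (a * t + 1))" by (simp add: mult_ac)
  then have "lam < (lam - C) * (a * t + 1)" using a by simp
  with C' show False by (simp add: algebra_simps)
qed

theorem theorem4:
  fixes r :: "'t::finite \<Rightarrow> real ^ 'n" and \<mu> :: "real ^ 'n" and \<beta> a \<eta> :: real
  assumes "a > 0" and "\<eta> > 0"
  shows "\<forall>lam \<ge> lambda_bar r \<mu> \<beta> a \<eta>. FP_optimal r \<mu> \<beta> a lam \<eta> 0"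
proof (intro allI impI)
  fix lam assume lam: "lambda_bar r \<mu> \<beta> a \<eta> \<le> lam"
  let ?e = "1 :: real ^ 't" and ?b = "constraint_rhs \<beta>"
  let ?R = "return_matrix r" and ?A = "constraint_matrix \<mu>"
  let ?T = "real CARD('t)"
  define C where "C = 1 / ?T * (norm (\<beta> *\<^sub>R ?e))\<^sup>2 + \<eta> * (norm ?b)\<^sup>2"
  define q where "q = (\<beta> / ?T) *\<^sub>R (transpose ?R *v ?e) + \<eta> *\<^sub>R (transpose ?A *v ?b)"
  define c where "c = infnorm q"
  have C0: "0 \<le> C" and c0: "0 \<le> c"
    using assms by (simp_all add: C_def c_def infnorm_pos_le)
  have lb: "lambda_bar r \<mu> \<beta> a \<eta> = C + 1 / a * c + 1 / a * sqrt (c\<^sup>2 + 2 * a * C * c)"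
    by (simp add: lambda_bar_def Let_def C_def c_def q_def)
  have "c \<le> sqrt (c\<^sup>2 + 2 * a * C * c)"
    using assms C0 c0 by (intro real_le_rsqrt) simp
  then have "2 * c \<le> a * (lambda_bar r \<mu> \<beta> a \<eta> - C)"
    using assms by (simp add: lb distrib_left)
  also have "\<dots> \<le> a * (lam - C)"
    using lam assms by (intro mult_left_mono) auto
  finally have thr: "2 * c \<le> a * (lam - C)" .
  \<comment> \<open>The sign of \<open>lam\<close> matters later, when the lower bound on the
    penalty is multiplied by it.\<close>
  have "0 \<le> a * (lam - C)" using thr c0 by linarith
  then have lam0: "0 \<le> lam" using C0 assms by (simp add: zero_le_mult_iff)
  have "FP_objective r \<mu> \<beta> a lam \<eta> 0 \<le> FP_objective r \<mu> \<beta> a lam \<eta> x" for x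
  proof -
    define t where "t = (\<Sum>i\<in>UNIV. \<bar>x $ i\<bar>)"
    define g where "g = 1 / ?T * (norm (?R *v x - \<beta> *\<^sub>R ?e))\<^sup>2 + \<eta> * (norm (?A *v x - ?b))\<^sup>2"
    have g0: "0 \<le> g" using assms by (simp add: g_def)
    \<comment> \<open>By linearity \<open>q\<close> collects the gradient terms of both residuals;
      its coefficient \<open>\<beta> / ?T\<close> comes from pulling \<open>\<beta>\<close> out of
      the transposed product.\<close>
    have "C - 2 * (q \<bullet> x)
        = 1 / ?T * ((norm (\<beta> *\<^sub>R ?e))\<^sup>2 - 2 * ((transpose ?R *v (\<beta> *\<^sub>R ?e)) \<bullet> x))
          + \<eta> * ((norm ?b)\<^sup>2 - 2 * ((transpose ?A *v ?b) \<bullet> x))"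
      by (simp only: C_def q_def matrix_vector_mult_scaleR inner_add_left inner_scaleR_left)
        (simp add: algebra_simps)
    also have "\<dots> \<le> g"
      unfolding g_def using assms
      by (intro add_mono mult_left_mono norm_matrix_residual_ge) auto
    finally have "C - 2 * c * t \<le> g"
      using inner_le_infnorm_mult_sum_abs[of q x] by (simp add: c_def t_def)
    \<comment> \<open>The two lower bounds \<open>0\<close> and \<open>C - 2 * c * t\<close> on
      \<open>g\<close> merge into \<open>C - min C (2 * c * t)\<close>.\<close>
    with g0 have "C \<le> g + min C (2 * c * t)" by simp
    also have "min C (2 * c * t) \<le> lam * frac_rho a t"
      using assms thr by (intro min_le_mult_frac_rho) (simp_all add: t_def sum_nonneg)
    also have "\<dots> \<le> lam * frac_penalty a x"
      unfolding t_def frac_penalty_def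
      using assms lam0 by (intro mult_left_mono frac_rho_sum_le) auto
    finally have "C \<le> g + lam * frac_penalty a x" by simp
    moreover have "FP_objective r \<mu> \<beta> a lam \<eta> 0 = C"
      by (simp add: FP_objective_def C_def frac_penalty_def frac_rho_def)
    ultimately show ?thesis
      by (simp add: FP_objective_def g_def)
  qed
  then show "FP_optimal r \<mu> \<beta> a lam \<eta> 0"
    by (simp add: FP_optimal_def is_arg_min_def not_less)
qed

end
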